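(* Let $n\ge 1$. The combinatorial barcode poset $(L(2^n)/\mathfrak{S}_n,\leq_c)$ is order-isomorphic to the principal ideal of the multinomial Newman lattice $L(2^n)$ generated by the ``fully nested'' multipermutation $(1~2~\ldots~(n-1)~n~n~(n-1)~\ldots~2~1)$. Consequently, $(L(2^n)/\mathfrak{S}_n,\leq_c)$ is a lattice.
   Context: Multinomial Newman lattice. For $\mathbf{m}=(m_1,\ldots,m_n)$ with positive integer entries, $L(\mathbf m)$ is the set of all permutations (written as words) of the multiset $\{1^{m_1},\ldots,n^{m_n}\}$ (exponents are multiplicities). Let $S=\{1_1,\ldots,1_{m_1},\ldots,n_1,\ldots,n_{m_n}\}$, totally ordered lexicographically ($1_1<1_2<\cdots<1_{m_1}<2_1<\cdots<n_{m_n}$), and let $\mathfrak{S}_S$ be the set of permutations of $S$ in one-line notation. The map $\iota:L(\mathbf m)\to\mathfrak{S}_S$ replaces, for each $i$, the successive occurrences of $i$ in the word, from left to right, by $i_1,i_2,\ldots,i_{m_i}$. For $\pi\in\mathfrak{S}_S$, $\mathrm{inv}(\pi)$ is the set of pairs $(\pi_a,\pi_b)$ with $a<b$ and $\pi_a>\pi_b$. The multinomial Newman order on $L(\mathbf m)$ is: $s\le t$ if and only if $\mathrm{inv}(\iota(s))\subseteq\mathrm{inv}(\iota(t))$. This makes $L(\mathbf m)$ a lattice. A principal ideal generated by $\alpha\in L$ is $\{s\in L: s\le\alpha\}$. $L(2^n)$ denotes $L(\mathbf m)$ with $\mathbf m=(2,\ldots,2)\in\mathbb{N}^n$. Combinatorial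 barcode poset. The symmetric group $\mathfrak{S}_n$ acts on $L(2^n)$ by relabeling entries: $\pi\circ s$ is obtained by applying $\pi$ to every entry of the word $s$. $[s]$ denotes the orbit of $s$ and $L(2^n)/\mathfrak{S}_n$ the set of orbits. For $s\in L(2^n)$, let $\tau_s\in\mathfrak{S}_n$ be the permutation whose one-line notation is the subword of $s$ formed by the first occurrence of each element. The canonical representative of $[s]$ is $\psi([s])=\tau_s^{-1}\circ s$, which does not depend on the choice of $s$ in its orbit (in it, the first occurrences of $1,2,\ldots,n$ appear in this order). The relation $\leq_c$ on $L(2^n)/\mathfrak{S}_n$ is: $[s]\leq_c[t]$ if and only if $\psi([s])\le\psi([t])$ in the multinomial Newman order. *)

theory Defs
  imports
    "HOL-Library.Multiset"
    "HOL-Library.Product_Lexorder"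
    "HOL-Algebra.Lattice"
    "HOL-Algebra.Group_Action"
    "HOL-Algebra.Sym_Groups"
begin

text \<open>
  Words are lists, and \<open>m = (m\<^sub>1, \<dots>, m\<^sub>n)\<close> is a list of length \<open>n\<close>, so that \<open>m\<^sub>i\<close> is
  \<open>m ! (i - 1)\<close>.
\<close>

definition multiperms :: "nat list \<Rightarrow> nat list set" where
  "multiperms m = {s. mset s = (\<Sum>i\<in>{1..length m}. replicate_mset (m ! (i - 1)) i)}"

text \<open>
  The element \<open>i\<^sub>j\<close> is the pair \<open>(i, j)\<close>; the instance from \<^theory>\<open>HOL-Library.Product_Lexorder\<close>
  orders these pairs lexicographically.
\<close>

definition standardize :: "nat list \<Rightarrow> (nat \<times> nat) list" where
  "standardize s = map (\<lambda>a. (s ! a, count_list (take (Suc a) s) (s ! a))) [0..<length s]"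

definition inversion_set :: "'a::linorder list \<Rightarrow> ('a \<times> 'a) set" where
  "inversion_set p = {(p ! a, p ! b) | a b. a < b \<and> b < length p \<and> p ! a > p ! b}"

definition newman_le :: "nat list \<Rightarrow> nat list \<Rightarrow> bool" where
  "newman_le s t \<longleftrightarrow> inversion_set (standardize s) \<subseteq> inversion_set (standardize t)"

definition newman :: "nat list \<Rightarrow> nat list gorder" where
  "newman m = \<lparr>carrier = multiperms m, eq = (=), le = newman_le\<rparr>"

definition principal_ideal :: "'a gorder \<Rightarrow> 'a \<Rightarrow> 'a gorder" where
  "principal_ideal L x = L\<lparr>carrier := {y \<in> carrier L. y \<sqsubseteq>\<^bsub>L\<^esub> x}\<rparr>"

text \<open>\<^const>\<open>remdups\<close> keeps last occurrences, hence the two reversals.\<close>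

definition first_occs :: "nat list \<Rightarrow> nat list" where
  "first_occs s = rev (remdups (rev s))"

definition first_occs_perm :: "nat list \<Rightarrow> nat \<Rightarrow> nat" where
  "first_occs_perm s i =
     (if i \<in> {1..length (first_occs s)} then first_occs s ! (i - 1) else i)"

text \<open>
  A permutation \<open>\<pi>\<close> acts on words by \<open>map \<pi>\<close>. On an orbit of \<open>\<SS>\<^sub>n\<close>, the word
  \<open>map (\<tau>\<^sub>s\<^sup>-\<^sup>1) s\<close> does not depend on the representative \<open>s\<close> (lemma \<open>canonical_rep_orbit\<close>),
  so that the image below is a singleton.
\<close>

definition canonical_rep :: "nat list set \<Rightarrow> nat list" where
  "canonical_rep A = the_elem ((\<lambda>s. map (inv' (first_occs_perm s)) s) ` A)"

definition barcode_poset :: "nat \<Rightarrow> nat list set gorder" where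
  "barcode_poset n =
     \<lparr>carrier = orbits (sym_group n) (multiperms (replicate n 2)) map,
      eq = (=),
      le = (\<lambda>A B. newman_le (canonical_rep A) (canonical_rep B))\<rparr>"

definition fully_nested :: "nat \<Rightarrow> nat list" where
  "fully_nested n = [1..<Suc n] @ rev [1..<Suc n]"

definition order_isomorphic :: "('a, 'c) gorder_scheme \<Rightarrow> ('b, 'd) gorder_scheme \<Rightarrow> bool" where
  "order_isomorphic A B \<longleftrightarrow> (\<exists>f. bij_betw f (carrier A) (carrier B) \<and> order_emb A B f)"

lemma set_multiperms_2:
  assumes "s \<in> multiperms (replicate n 2)"
  shows "set s = {1..n}"
proof -
  have "set_mset (mset s) = {1..n}"
    using assms by (auto simp: multiperms_def set_mset_sum)
  then show ?thesis by simp
qed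

lemma fully_nested_in_multiperms: "fully_nested n \<in> multiperms (replicate n 2)"
proof -
  have "mset (fully_nested n) = (\<Sum>i\<in>{1..n}. replicate_mset 2 i)"
    by (induction n) (auto simp: fully_nested_def numeral_2_eq_2)
  also have "\<dots> = (\<Sum>i\<in>{1..n}. replicate_mset (replicate n 2 ! (i - 1)) i)"
    by (intro sum.cong refl) auto
  finally show ?thesis by (simp add: multiperms_def)
qed

lemma first_occs_perm_permutes:
  assumes "set s = {1..n}"
  shows "first_occs_perm s permutes {1..n}"
proof -
  let ?f = "first_occs s"
  have d: "distinct ?f" and st: "set ?f = {1..n}"
    using assms by (simp_all add: first_occs_def)
  have len: "length ?f = n"
    using distinct_card[OF d] st by simp
  have "inj_on (first_occs_perm s) {1..n}"
    using d len by (auto simp: inj_on_def first_occs_perm_def nth_eq_iff_index_eq)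
  moreover have "first_occs_perm s ` {1..n} \<subseteq> {1..n}"
  proof safe
    fix i assume "i \<in> {1..n}"
    then have "?f ! (i - 1) \<in> set ?f" using len by (intro nth_mem) auto
    then show "first_occs_perm s i \<in> {1..n}"
      using \<open>i \<in> {1..n}\<close> len st by (simp add: first_occs_perm_def)
  qed
  ultimately have "bij_betw (first_occs_perm s) {1..n} {1..n}"
    by (simp add: bij_betw_def endo_inj_surj)
  then show ?thesis
    by (rule bij_imp_permutes) (auto simp: first_occs_perm_def len)
qed

lemma first_occs_map:
  assumes "inj p"
  shows "first_occs (map p s) = map p (first_occs s)"
proof -
  have "remdups (map p xs) = map p (remdups xs)" for xs
    using assms by (induction xs) (auto simp: inj_def)
  then show ?thesis by (simp add: first_occs_def rev_map)
qed

lemma canonical_rep_orbit: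
  assumes s: "s \<in> multiperms (replicate n 2)"
  shows "canonical_rep (orbit (sym_group n) map s) = map (inv' (first_occs_perm s)) s"
proof -
  have indep: "map (inv' (first_occs_perm (map p s))) (map p s) = map (inv' (first_occs_perm s)) s"
    if p: "p permutes {1..n}" for p
  proof -
    have st: "set s = {1..n}" using s by (rule set_multiperms_2)
    then have t: "first_occs_perm s permutes {1..n}" by (rule first_occs_perm_permutes)
    have stp: "set (map p s) = {1..n}" using st permutes_image[OF p] by simp
    then have tp: "first_occs_perm (map p s) permutes {1..n}" by (rule first_occs_perm_permutes)
    have len: "length (first_occs s) = n"
      using distinct_card[of "first_occs s"] st by (simp add: first_occs_def)
    have comm: "first_occs_perm (map p s) i = p (first_occs_perm s i)" if "i \<in> {1..n}" for i
    proof -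
      have "i - 1 < length (first_occs s)" using that len by auto
      then show ?thesis
        using that len by (simp add: first_occs_perm_def first_occs_map[OF permutes_inj[OF p]])
    qed
    have "inv' (first_occs_perm (map p s)) (p x) = inv' (first_occs_perm s) x"
      if x: "x \<in> {1..n}" for x
    proof -
      define i where "i = inv' (first_occs_perm s) x"
      have "i \<in> {1..n}"
        using x permutes_in_image[OF permutes_inv[OF t]] by (simp add: i_def)
      moreover have "first_occs_perm s i = x"
        by (simp only: i_def permutes_inverses(1)[OF t])
      ultimately have "first_occs_perm (map p s) i = p x"
        using comm by simp
      then have "inv' (first_occs_perm (map p s)) (p x) = i"
        using permutes_inverses(2)[OF tp, of i] by simp
      then show ?thesis by (simp add: i_def)
    qed
    then show ?thesis using st by simp
  qed
  have orb: "orbit (sym_group n) map s = {map p s | p. p permutes {1..n}}"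
    by (simp only: orbit_def sym_group_carrier)
  have "map id s \<in> orbit (sym_group n) map s"
    unfolding orb using permutes_id by blast
  then have "s \<in> orbit (sym_group n) map s"
    by (simp only: list.map_id)
  moreover have "map (inv' (first_occs_perm t)) t = map (inv' (first_occs_perm s)) s"
    if "t \<in> orbit (sym_group n) map s" for t
    using that indep unfolding orb by blast
  ultimately have "(\<lambda>t. map (inv' (first_occs_perm t)) t) ` orbit (sym_group n) map s
      = {map (inv' (first_occs_perm s)) s}"
    by blast
  then show ?thesis by (simp add: canonical_rep_def)
qed

end

theory Submission
  imports Defs
begin

text \<open>
  The inversion sets of the orderings of a finite chain are exactly the biclosed sets: the sets of
  pairs \<open>(x, y)\<close> with \<open>x > y\<close> that are transitive and whose complement among these pairs is too.
  The transitive closure of a union of biclosed sets is biclosed; this gives suprema in every principal ideal of the Newman order, and infima are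
  suprema of lower bounds. The inversions of the standardized fully nested word are the pairs
  \<open>(i\<^sub>x, j\<^sub>2)\<close> with \<open>i > j\<close>. So a word lies below it iff it has no inversion \<open>(i\<^sub>1, j\<^sub>1)\<close>, that is, iff its
  first occurrences appear in the order \<open>1, \<dots>, n\<close>. Hence the ideal consists of the canonical
  representatives of the orbits.
\<close>

section \<open>Inversion sets of lists\<close>

lemma inversion_set_Nil [simp]: "inversion_set [] = {}"
  by (simp add: inversion_set_def)

lemma inversion_set_Cons:
  "inversion_set (x # p) = {(x, y) | y. y \<in> set p \<and> y < x} \<union> inversion_set p" (is "?L = ?R")
proof (intro equalityI subsetI)
  fix z assume "z \<in> ?L"
  then obtain a b where ab: "a < b" "b < Suc (length p)" "(x # p) ! a > (x # p) ! b"
    and z: "z = ((x # p) ! a, (x # p) ! b)"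
    by (auto simp: inversion_set_def)
  from ab obtain b' where b': "b = Suc b'" by (cases b) auto
  show "z \<in> ?R"
  proof (cases a)
    case 0
    with ab z b' show ?thesis by auto
  next
    case (Suc a')
    with ab z b' show ?thesis by (auto simp: inversion_set_def)
  qed
next
  fix z assume "z \<in> ?R"
  then show "z \<in> ?L"
  proof
    assume "z \<in> {(x, y) | y. y \<in> set p \<and> y < x}"
    then obtain b where "b < length p" "p ! b < x" "z = (x, p ! b)"
      by (auto simp: in_set_conv_nth)
    then show ?thesis
      unfolding inversion_set_def
      by (intro CollectI exI[of _ 0] exI[of _ "Suc b"]) auto
  next
    assume "z \<in> inversion_set p"
    then obtain a b where "a < b" "b < length p" "p ! a > p ! b" "z = (p ! a, p ! b)"
      by (auto simp: inversion_set_def)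
    then show ?thesis
      unfolding inversion_set_def
      by (intro CollectI exI[of _ "Suc a"] exI[of _ "Suc b"]) auto
  qed
qed

lemma inversion_set_append:
  "inversion_set (p @ q) =
     inversion_set p \<union> inversion_set q \<union> {(x, y). x \<in> set p \<and> y \<in> set q \<and> y < x}"
  by (induction p) (auto simp: inversion_set_Cons)

lemma inversion_set_subset: "inversion_set p \<subseteq> {(x, y). x \<in> set p \<and> y \<in> set p \<and> y < x}"
  by (induction p) (auto simp: inversion_set_Cons)

lemma inversion_set_filter:
  "inversion_set (filter P p) = {(x, y). (x, y) \<in> inversion_set p \<and> P x \<and> P y}"
  by (induction p) (auto simp: inversion_set_Cons)

lemma inversion_set_empty_iff: "inversion_set p = {} \<longleftrightarrow> sorted p"
proof (induction p)
  case (Cons x p)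
  then show ?case by (auto simp: inversion_set_Cons not_less)
qed simp

lemma inversion_set_rev_sorted:
  assumes "sorted p"
  shows "inversion_set (rev p) = {(x, y). x \<in> set p \<and> y \<in> set p \<and> y < x}"
  using assms by (induction p) (auto simp: inversion_set_append inversion_set_Cons)

text \<open>Induction on the head. If the heads \<open>x\<close> of \<open>p\<close> and
  \<open>y\<close> of \<open>q\<close> differed, say \<open>x < y\<close>, then
  \<open>(y, x)\<close> would be an inversion of \<open>q\<close>, where \<open>y\<close> stands
  first, but not of \<open>p\<close>, where \<open>x\<close> does. Once the heads agree, the
  inversions of the tails are those among the remaining elements.\<close>

lemma distinct_inversion_set_unique:
  assumes "distinct p" "distinct q" "set p = set q" "inversion_set p = inversion_set q"
  shows "p = q"
  using assms
proof (induction p arbitrary: q)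
  case (Cons x p)
  then obtain y q' where q: "q = y # q'" by (cases q) auto
  have "x = y"
  proof (rule ccontr)
    assume "x \<noteq> y"
    then have mem: "y \<in> set p" "x \<in> set q'" using Cons.prems(3) q by auto
    have sp: "inversion_set p \<subseteq> set p \<times> set p" and sq: "inversion_set q' \<subseteq> set q' \<times> set q'"
      using inversion_set_subset by auto
    consider "x < y" | "y < x" using \<open>x \<noteq> y\<close> by fastforce
    then show False
    proof cases
      case 1
      then have "(y, x) \<in> inversion_set (x # p)"
        using mem Cons.prems(4) q by (auto simp: inversion_set_Cons)
      then show False using sp Cons.prems(1) 1 by (auto simp: inversion_set_Cons)
    next
      case 2
      then have "(x, y) \<in> inversion_set (y # q')"
        using mem Cons.prems(4) q by (auto simp: inversion_set_Cons)
      then show False using sq Cons.prems(2) q 2 by (auto simp: inversion_set_Cons)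
    qed
  qed
  have st: "set p = set q'" using Cons.prems q \<open>x = y\<close> by auto
  have x: "x \<notin> set p" "x \<notin> set q'" using Cons.prems q \<open>x = y\<close> by auto
  have "inversion_set p = inversion_set (x # p) \<inter> set p \<times> set p"
    using inversion_set_subset[of p] x by (auto simp: inversion_set_Cons)
  also have "\<dots> = inversion_set (x # q') \<inter> set q' \<times> set q'"
    using Cons.prems(4) q st \<open>x = y\<close> by simp
  also have "\<dots> = inversion_set q'"
    using inversion_set_subset[of q'] x by (auto simp: inversion_set_Cons)
  finally have "inversion_set p = inversion_set q'" .
  then have "p = q'" using Cons.IH[of q'] Cons.prems q st by simp
  then show ?case using q \<open>x = y\<close> by simp
qed simp

section \<open>Biclosed sets\<close>

text \<open>The last clause is the contrapositive of transitivity of the complement. For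
  \<open>X = {1..n}\<close> these are the biclosed sets of positive roots of type A.\<close>

definition biclosed :: "'a::linorder set \<Rightarrow> ('a \<times> 'a) set \<Rightarrow> bool" where
  "biclosed X J \<longleftrightarrow>
     J \<subseteq> {(x, y). x \<in> X \<and> y \<in> X \<and> y < x} \<and> trans J \<and>
     (\<forall>x y z. (x, z) \<in> J \<longrightarrow> y \<in> X \<longrightarrow> z < y \<longrightarrow> y < x \<longrightarrow> (x, y) \<in> J \<or> (y, z) \<in> J)"

text \<open>Transitivity comes from the order of positions. For the last clause, \<open>x\<close>
  stands to the left of \<open>z\<close>, so any third element stands to the right of
  \<open>x\<close> or to the left of \<open>z\<close>.\<close>

lemma biclosed_inversion_set:
  assumes "distinct p"
  shows "biclosed (set p) (inversion_set p)"
proof -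
  have "trans (inversion_set p)"
  proof (rule transI)
    fix x y z assume "(x, y) \<in> inversion_set p" "(y, z) \<in> inversion_set p"
    then obtain a b b' c where
      *: "a < b" "b < length p" "b' < c" "c < length p" "p ! b = p ! b'"
         "p ! b < p ! a" "p ! c < p ! b'" "x = p ! a" "z = p ! c"
      by (auto simp: inversion_set_def)
    then have "b = b'" using nth_eq_iff_index_eq[OF assms] by auto
    with * show "(x, z) \<in> inversion_set p"
      unfolding inversion_set_def by (intro CollectI exI[of _ a] exI[of _ c]) auto
  qed
  moreover have "(x, y) \<in> inversion_set p \<or> (y, z) \<in> inversion_set p"
    if xz: "(x, z) \<in> inversion_set p" and "y \<in> set p" "z < y" "y < x" for x y z
  proof -
    obtain a c where ac: "a < c" "c < length p" "x = p ! a" "z = p ! c"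
      using xz by (auto simp: inversion_set_def)
    obtain b where b: "b < length p" "y = p ! b"
      using \<open>y \<in> set p\<close> by (auto simp: in_set_conv_nth)
    show ?thesis
    proof (cases "a < b")
      case True
      then have "(x, y) \<in> inversion_set p"
        using ac b \<open>y < x\<close> unfolding inversion_set_def by blast
      then show ?thesis ..
    next
      case False
      then have "(y, z) \<in> inversion_set p"
        using ac b \<open>z < y\<close> unfolding inversion_set_def
        by (intro CollectI exI[of _ b] exI[of _ c]) auto
      then show ?thesis ..
    qed
  qed
  ultimately show ?thesis
    using inversion_set_subset unfolding biclosed_def by blast
qed

lemma biclosed_imp_inversion_set:
  assumes fin: "finite X" and J: "biclosed X J"
  obtains p where "distinct p" "set p = X" "inversion_set p = J"
proof -
  \<comment> \<open>\<open>R x y\<close> prescribes that \<open>x\<close> stands before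
    \<open>y\<close>: the given order, reversed on the pairs of \<open>J\<close>. Biclosedness makes
    it a strict linear order on \<open>X\<close>.\<close>
  define R where "R x y \<longleftrightarrow> x < y \<and> (y, x) \<notin> J \<or> (x, y) \<in> J" for x y
  have sub: "x \<in> X" "y \<in> X" "y < x" if "(x, y) \<in> J" for x y
    using J that by (auto simp: biclosed_def)
  have tr: "(x, z) \<in> J" if "(x, y) \<in> J" "(y, z) \<in> J" for x y z
    using J that unfolding biclosed_def by (meson transD)
  have co: "(x, y) \<in> J \<or> (y, z) \<in> J" if "(x, z) \<in> J" "y \<in> X" "z < y" "y < x" for x y z
    using J that by (simp add: biclosed_def)
  have irrefl: "\<not> R x x" for x using sub(3) by (auto simp: R_def)
  have total: "R x y \<or> R y x" if "x \<noteq> y" for x y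
    using that by (auto simp: R_def)
  have asym: "\<not> (R x y \<and> R y x)" for x y
    unfolding R_def using sub(3) by (metis order.asym)
  have transR: "R x z" if X: "x \<in> X" "y \<in> X" "z \<in> X" and xy: "R x y" and yz: "R y z" for x y z
  proof (rule ccontr)
    assume "\<not> R x z"
    moreover have "x \<noteq> z" using asym xy yz by blast
    ultimately have zx: "R z x" using total by blast
    \<comment> \<open>A 3-cycle of \<open>R\<close> has two ascents, contradicting
      \<open>co\<close>, or two descents, contradicting \<open>tr\<close>. In the mixed cases,
      comparing \<open>x\<close> with \<open>z\<close> decides which, after rotating the
      cycle.\<close>
    consider "x < y" "y < z" | "x < y" "z < y" | "y < x" "y < z" | "y < x" "z < y"
      using xy yz irrefl by (metis linorder_neqE)
    then show False
    proof cases
      case 1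
      then show False using xy yz zx X co[of z x y] sub(3) unfolding R_def by (metis order.asym order.strict_trans)
    next
      case 2
      then show False using xy yz zx X co tr sub(3) \<open>x \<noteq> z\<close> unfolding R_def by (metis linorder_neqE order.asym)
    next
      case 3
      then show False using xy yz zx X co tr sub(3) \<open>x \<noteq> z\<close> unfolding R_def by (metis linorder_neqE order.asym)
    next
      case 4
      then show False using xy yz zx X tr sub(3) unfolding R_def by (metis order.asym)
    qed
  qed
  \<comment> \<open>The number of \<open>R\<close>-predecessors is strictly increasing along
    \<open>R\<close>, so sorting by it lists \<open>X\<close> in the order \<open>R\<close>.\<close>
  define rank where "rank x = card {y \<in> X. R y x}" for x
  have mono: "rank x < rank y" if "x \<in> X" "y \<in> X" "R x y" for x y
  proof -
    have "{z \<in> X. R z x} \<subset> {z \<in> X. R z y}"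
      using that transR irrefl by blast
    then show ?thesis using fin by (simp add: rank_def psubset_card_mono)
  qed
  define p where "p = sort_key rank (sorted_list_of_set X)"
  have p: "distinct p" "set p = X" using fin by (simp_all add: p_def)
  have sorted: "sorted (map rank p)" by (simp add: p_def)
  have ord: "R (p ! a) (p ! b)" if "a < b" "b < length p" for a b
  proof -
    have "rank (p ! a) \<le> rank (p ! b)"
      using sorted that by (auto simp: sorted_iff_nth_mono)
    moreover have "p ! a \<noteq> p ! b" using that p(1) by (simp add: nth_eq_iff_index_eq)
    moreover have "p ! a \<in> X" "p ! b \<in> X" using that p(2) by auto
    ultimately show ?thesis using total mono by (metis linorder_not_le)
  qed
  have "inversion_set p = J"
  proof (intro equalityI subrelI)
    fix x y assume "(x, y) \<in> inversion_set p"
    then have "R x y" "y < x" using ord by (auto simp: inversion_set_def)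
    then show "(x, y) \<in> J" by (auto simp: R_def)
  next
    fix x y assume xy: "(x, y) \<in> J"
    then obtain a b where ab: "a < length p" "b < length p" "x = p ! a" "y = p ! b"
      using sub p(2) by (metis in_set_conv_nth)
    have "R x y" using xy by (simp add: R_def)
    then have "a < b" using ord asym ab irrefl by (metis linorder_neqE_nat)
    then show "(x, y) \<in> inversion_set p"
      using ab sub(3)[OF xy] unfolding inversion_set_def by blast
  qed
  with p that show ?thesis by blast
qed

text \<open>A pair of the closure is a descending chain of pairs from members of \<open>F\<close>. A
  value \<open>y\<close> between its ends is either on the chain, which is then cut there, or
  strictly inside one step; the member containing that step is biclosed and connects
  \<open>y\<close> to one end of the step. The induction tests the last step first.\<close>

lemma biclosed_trancl_Union:
  assumes F: "\<And>J. J \<in> F \<Longrightarrow> biclosed X J"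
  shows "biclosed X ((\<Union>F)\<^sup>+)"
proof -
  have sub: "(\<Union>F)\<^sup>+ \<subseteq> {(x, y). x \<in> X \<and> y \<in> X \<and> y < x}"
  proof -
    let ?S = "{(x, y). x \<in> X \<and> y \<in> X \<and> y < x}"
    have "\<Union>F \<subseteq> ?S"
      using F unfolding biclosed_def by blast
    then have "(\<Union>F)\<^sup>+ \<subseteq> ?S\<^sup>+"
      by (rule trancl_mono_subset)
    also have "?S\<^sup>+ = ?S"
      by (rule trancl_id) (auto intro: transI)
    finally show ?thesis .
  qed
  have co: "(x, y) \<in> J \<or> (y, z) \<in> J"
    if "J \<in> F" "(x, z) \<in> J" "y \<in> X" "z < y" "y < x" for J x y z
    using F that by (simp add: biclosed_def)
  have "(x, y) \<in> (\<Union>F)\<^sup>+ \<or> (y, z) \<in> (\<Union>F)\<^sup>+"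
    if "(x, z) \<in> (\<Union>F)\<^sup>+" "y \<in> X" "z < y" "y < x" for x y z
    using that(1,3,4)
  proof (induction rule: trancl_induct)
    case (base z)
    then show ?case using co \<open>y \<in> X\<close> by blast
  next
    case (step z w)
    consider "y = z" | "z < y" | "y < z" by fastforce
    then show ?case
    proof cases
      case 1
      then show ?thesis using step.hyps by blast
    next
      case 2
      then show ?thesis using step by (meson trancl.trancl_into_trancl)
    next
      case 3
      then have "(z, y) \<in> \<Union>F \<or> (y, w) \<in> \<Union>F"
        using step.hyps step.prems co \<open>y \<in> X\<close> by blast
      then show ?thesis using step.hyps by (meson trancl.trancl_into_trancl r_into_trancl)
    qed
  qed
  then show ?thesis
    using sub trans_trancl unfolding biclosed_def by blast
qed

section \<open>Standardization\<close>

lemma map_fst_standardize [simp]: "map fst (standardize s) = s"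
  by (simp add: standardize_def comp_def map_nth)

lemma standardize_Nil [simp]: "standardize [] = []"
  by (simp add: standardize_def)

lemma standardize_append:
  "standardize (s @ t) = standardize s @ map (\<lambda>(i, j). (i, count_list s i + j)) (standardize t)"
  by (rule nth_equalityI) (auto simp: standardize_def nth_append Suc_diff_le)

lemma standardize_snoc: "standardize (s @ [x]) = standardize s @ [(x, Suc (count_list s x))]"
  by (simp add: standardize_append) (simp add: standardize_def)

lemma standardize_distinct:
  assumes "distinct s"
  shows "standardize s = map (\<lambda>i. (i, 1)) s"
  using assms by (induction s rule: rev_induct) (auto simp: standardize_snoc count_list_0_iff)

lemma count_list_distinct: "distinct xs \<Longrightarrow> count_list xs x = (if x \<in> set xs then 1 else 0)"
  by (induction xs) auto

lemma set_standardize: "set (standardize s) = {(i, j). 1 \<le> j \<and> j \<le> count_list s i}"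
  by (induction s rule: rev_induct) (auto simp: standardize_snoc split: if_splits)

lemma distinct_standardize: "distinct (standardize s)"
  by (induction s rule: rev_induct) (auto simp: standardize_snoc set_standardize)

text \<open>Copies of one letter are numbered from left to right, so no two of them are
  inverted.\<close>

lemma inversion_set_standardize_subset:
  "inversion_set (standardize s) \<subseteq> {(x, y). fst y < fst x}"
proof (induction s rule: rev_induct)
  case (snoc x s)
  have "x < a" if "x \<le> a" "b \<le> count_list s a" "Suc (count_list s x) < b" for a b
    using that by (cases "a = x") auto
  then show ?case
    using snoc
    by (auto simp: standardize_snoc set_standardize inversion_set_append inversion_set_Cons)
qed simp

lemma biclosed_standardize:
  "biclosed (set (standardize s)) (inversion_set (standardize s))"
  by (rule biclosed_inversion_set[OF distinct_standardize])

lemma set_standardize_cong: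
  assumes "mset s = mset t"
  shows "set (standardize s) = set (standardize t)"
  using assms by (simp add: set_standardize flip: count_mset)

text \<open>This describes the image of \<open>standardize\<close>: it suffices that every copy of a
  letter other than the first has the preceding copy somewhere to its left.\<close>

lemma standardize_map_fst:
  assumes "distinct p"
    and "\<And>xs i j ys. p = xs @ (i, j) # ys \<Longrightarrow> 1 \<le> j \<and> (1 < j \<longrightarrow> (i, j - 1) \<in> set xs)"
  shows "standardize (map fst p) = p"
  using assms
proof (induction p rule: rev_induct)
  case (snoc x p)
  obtain i j where x: "x = (i, j)" by (cases x)
  have IH: "standardize (map fst p) = p"
  proof (rule snoc.IH)
    fix xs i j ys assume "p = xs @ (i, j) # ys"
    then show "1 \<le> j \<and> (1 < j \<longrightarrow> (i, j - 1) \<in> set xs)"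
      using snoc.prems(2)[of xs i j "ys @ [x]"] by simp
  qed (use snoc.prems(1) in simp)
  have mem: "(a, b) \<in> set p \<longleftrightarrow> 1 \<le> b \<and> b \<le> count_list (map fst p) a" for a b
    using set_standardize[of "map fst p"] unfolding IH by blast
  have "1 \<le> j" "1 < j \<longrightarrow> (i, j - 1) \<in> set p" "(i, j) \<notin> set p"
    using snoc.prems(2)[of p i j "[]"] snoc.prems(1) x by auto
  \<comment> \<open>By \<open>mem\<close>, the labels of \<open>i\<close> in \<open>p\<close> are
    exactly 1 up to its count. The label \<open>j\<close> is not among them, whereas
    \<open>j - 1\<close> is, unless \<open>j = 1\<close>.\<close>
  then have "j = Suc (count_list (map fst p) i)"
    unfolding mem by linarith
  then show ?case using IH x by (simp add: standardize_snoc)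
qed simp

text \<open>Biclosedness alone yields an ordering of the labelled letters. By \<open>le\<close> the
  copies of each letter are in increasing order, so this ordering is the standardization of the word
  left after forgetting labels.\<close>

lemma biclosed_imp_word:
  assumes J: "biclosed (set (standardize s)) J" and le: "J \<subseteq> {(x, y). fst y < fst x}"
  obtains t where "mset t = mset s" "inversion_set (standardize t) = J"
proof -
  obtain p where p: "distinct p" "set p = set (standardize s)" "inversion_set p = J"
    using biclosed_imp_inversion_set[OF _ J] by blast
  have "standardize (map fst p) = p"
  proof (rule standardize_map_fst[OF p(1)])
    fix xs i j ys assume split: "p = xs @ (i, j) # ys"
    have "(i, j) \<in> set (standardize s)" using p(2) split by auto
    then have j: "1 \<le> j" "j \<le> count_list s i" by (auto simp: set_standardize)
    have "(i, j - 1) \<in> set xs" if "1 < j"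
    proof (rule ccontr)
      assume "(i, j - 1) \<notin> set xs"
      moreover have "1 \<le> j - 1" "j - 1 \<le> count_list s i" using j that by auto
      then have "(i, j - 1) \<in> set p" using p(2) by (simp add: set_standardize)
      ultimately have "(i, j - 1) \<in> set ys" using split that by auto
      then have "((i, j), (i, j - 1)) \<in> J"
        using that split by (simp add: inversion_set_append inversion_set_Cons flip: p(3))
      then show False using le by auto
    qed
    with j show "1 \<le> j \<and> (1 < j \<longrightarrow> (i, j - 1) \<in> set xs)" by simp
  qed
  moreover have "mset p = mset (standardize s)"
    using p(1,2) distinct_standardize set_eq_iff_mset_eq_distinct by blast
  then have "mset (map fst p) = mset (map fst (standardize s))" by (simp only: mset_map)
  ultimately show ?thesis using that[of "map fst p"] p(3) by simp
qed

lemma inversion_set_standardize_inj: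
  assumes "mset s = mset t" "inversion_set (standardize s) = inversion_set (standardize t)"
  shows "s = t"
proof -
  have "standardize s = standardize t"
    using assms set_standardize_cong distinct_standardize distinct_inversion_set_unique by metis
  then show ?thesis by (metis map_fst_standardize)
qed

section \<open>Principal ideals of the Newman order are lattices\<close>

lemma mset_multiperms:
  assumes "s \<in> multiperms m"
  shows "t \<in> multiperms m \<longleftrightarrow> mset t = mset s"
  using assms by (simp add: multiperms_def)

lemma newman_le_antisym:
  assumes "s \<in> multiperms m" "t \<in> multiperms m" "newman_le s t" "newman_le t s"
  shows "s = t"
  using mset_multiperms[OF assms(2), of s] assms
  by (intro inversion_set_standardize_inj) (auto simp: newman_le_def)

text \<open>The supremum has as inversion set the transitive closure of the union. Inversion sets
  are transitive, so this closure lies in that of every upper bound; applied to \<open>u\<close>,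
  this keeps it free of pairs of equal letters, as \<open>biclosed_imp_word\<close> requires. In the
  last clause \<open>t\<close> ranges over all words.\<close>

lemma newman_ideal_Sup:
  assumes u: "u \<in> multiperms m" and W: "W \<subseteq> multiperms m" and Wu: "\<And>w. w \<in> W \<Longrightarrow> newman_le w u"
  obtains s where "s \<in> multiperms m" "\<And>w. w \<in> W \<Longrightarrow> newman_le w s"
    "\<And>t. (\<And>w. w \<in> W \<Longrightarrow> newman_le w t) \<Longrightarrow> newman_le s t"
proof -
  let ?I = "\<lambda>w. inversion_set (standardize w)"
  let ?J = "(\<Union>(?I ` W))\<^sup>+"
  have below: "?J \<subseteq> ?I t" if "\<And>w. w \<in> W \<Longrightarrow> newman_le w t" for t
  proof -
    have "\<Union>(?I ` W) \<subseteq> ?I t" using that by (auto simp: newman_le_def)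
    moreover have "trans (?I t)" using biclosed_standardize by (auto simp: biclosed_def)
    ultimately show ?thesis by (metis trancl_mono_subset trancl_id)
  qed
  have "biclosed (set (standardize u)) ?J"
  proof (rule biclosed_trancl_Union)
    fix J assume "J \<in> ?I ` W"
    then obtain w where "w \<in> W" "J = ?I w" by blast
    moreover have "mset w = mset u" using \<open>w \<in> W\<close> W u mset_multiperms by blast
    ultimately show "biclosed (set (standardize u)) J"
      using biclosed_standardize[of w] set_standardize_cong[of w u] by simp
  qed
  moreover have "?J \<subseteq> {(x, y). fst y < fst x}"
    using below[OF Wu] inversion_set_standardize_subset by blast
  ultimately obtain s where s: "mset s = mset u" "?I s = ?J"
    by (rule biclosed_imp_word)
  show ?thesis
  proof (rule that[of s])
    show "s \<in> multiperms m" using s(1) u mset_multiperms by blast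
    show "newman_le w s" if "w \<in> W" for w
      using that s(2) by (auto simp: newman_le_def)
    show "newman_le s t" if "\<And>w. w \<in> W \<Longrightarrow> newman_le w t" for t
      using below[OF that] s(2) by (simp add: newman_le_def)
  qed
qed

lemma newman_le_trans: "newman_le s t \<Longrightarrow> newman_le t u \<Longrightarrow> newman_le s u"
  by (auto simp: newman_le_def)

lemma carrier_newman_ideal [simp]:
  "carrier (principal_ideal (newman m) u) = {s \<in> multiperms m. newman_le s u}"
  by (simp add: principal_ideal_def newman_def)

lemma le_newman_ideal [simp]: "le (principal_ideal (newman m) u) = newman_le"
  by (simp add: principal_ideal_def newman_def)

lemma eq_newman_ideal [simp]: "eq (principal_ideal (newman m) u) = (=)"
  by (simp add: principal_ideal_def newman_def)

lemma newman_ideal_lattice: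
  assumes u: "u \<in> multiperms m"
  shows "lattice (principal_ideal (newman m) u)" (is "lattice ?P")
proof unfold_locales
  fix s t assume st: "s \<in> carrier ?P" "t \<in> carrier ?P"
  obtain j where j: "j \<in> multiperms m" "\<And>w. w \<in> {s, t} \<Longrightarrow> newman_le w j"
    "\<And>v. (\<And>w. w \<in> {s, t} \<Longrightarrow> newman_le w v) \<Longrightarrow> newman_le j v"
    using newman_ideal_Sup[OF u, of "{s, t}"] st by auto
  moreover have "newman_le j u" using j(3)[of u] st by auto
  ultimately show "\<exists>j. least ?P j (Upper ?P {s, t})"
    using st by (intro exI[of _ j]) (auto simp: least_def Upper_def)
  \<comment> \<open>Both \<open>s\<close> and \<open>t\<close> bound \<open>?W\<close> from above,
    so its supremum \<open>k\<close> lies below both, and thereby in the ideal.\<close>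
  let ?W = "{w \<in> multiperms m. newman_le w s \<and> newman_le w t}"
  obtain k where k: "k \<in> multiperms m" "\<And>w. w \<in> ?W \<Longrightarrow> newman_le w k"
    "\<And>v. (\<And>w. w \<in> ?W \<Longrightarrow> newman_le w v) \<Longrightarrow> newman_le k v"
  proof (rule newman_ideal_Sup[OF u, of ?W])
    show "newman_le w u" if "w \<in> ?W" for w
      using that st newman_le_trans by auto
  qed auto
  moreover have "newman_le k s" "newman_le k t" using k(3) by auto
  moreover have "newman_le k u" using \<open>newman_le k s\<close> st newman_le_trans by auto
  ultimately show "\<exists>k. greatest ?P k (Lower ?P {s, t})"
    using st by (intro exI[of _ k]) (auto simp: greatest_def Lower_def)
qed (auto simp: newman_le_def intro: newman_le_antisym[unfolded newman_le_def])

section \<open>Transport of the lattice property along order isomorphisms\<close>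

lemma least_Upper_pair:
  assumes "x \<in> carrier L" "y \<in> carrier L"
  shows "least L s (Upper L {x, y}) \<longleftrightarrow> s \<in> carrier L \<and> le L x s \<and> le L y s \<and>
    (\<forall>u\<in>carrier L. le L x u \<longrightarrow> le L y u \<longrightarrow> le L s u)"
  using assms by (auto simp: least_def Upper_def)

lemma greatest_Lower_pair:
  assumes "x \<in> carrier L" "y \<in> carrier L"
  shows "greatest L s (Lower L {x, y}) \<longleftrightarrow> s \<in> carrier L \<and> le L s x \<and> le L s y \<and>
    (\<forall>u\<in>carrier L. le L u x \<longrightarrow> le L u y \<longrightarrow> le L u s)"
  using assms by (auto simp: greatest_def Lower_def)

text \<open>Suprema and infima of pairs are pulled back along \<open>f\<close>, using the two
  characterizations above, which quantify only over the carrier. An embedding gives merely a weak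
  partial order on \<open>A\<close>; the hypothesis \<open>eq\<close> supplies the strict equality
  that \<open>lattice\<close> demands.\<close>

lemma order_isomorphic_lattice:
  assumes iso: "order_isomorphic A B" and B: "lattice B" and eq: "eq A = (=)"
  shows "lattice A"
proof -
  interpret B: lattice B by (rule B)
  obtain f where f: "bij_betw f (carrier A) (carrier B)" and emb: "order_emb A B f"
    using iso by (auto simp: order_isomorphic_def)
  interpret A: weak_partial_order A using emb by (simp add: order_emb_def)
  have le: "le B (f x) (f y) \<longleftrightarrow> le A x y" if "x \<in> carrier A" "y \<in> carrier A" for x y
    using emb that by (simp add: order_emb_def)
  have img: "carrier B = f ` carrier A" using f by (simp add: bij_betw_def)
  show ?thesis
  proof unfold_locales
    fix x y assume xy: "x \<in> carrier A" "y \<in> carrier A"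
    then have "f x \<in> carrier B" "f y \<in> carrier B" using img by auto
    then obtain s t where "least B s (Upper B {f x, f y})" "greatest B t (Lower B {f x, f y})"
      using B.sup_of_two_exists B.inf_of_two_exists by metis
    moreover from this have "s \<in> f ` carrier A" "t \<in> f ` carrier A"
      using img by (auto simp: least_def Upper_def greatest_def Lower_def)
    ultimately obtain s t where s: "s \<in> carrier A" "least B (f s) (Upper B {f x, f y})"
      and t: "t \<in> carrier A" "greatest B (f t) (Lower B {f x, f y})" by blast
    have "f x \<in> carrier B" "f y \<in> carrier B" using xy img by auto
    then have "least A s (Upper A {x, y})" "greatest A t (Lower A {x, y})"
      using s t xy by (simp_all add: least_Upper_pair greatest_Lower_pair img le)
    then show "\<exists>s. least A s (Upper A {x, y})" "\<exists>t. greatest A t (Lower A {x, y})"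
      by blast+
  qed (rule eq)
qed

section \<open>The ideal below the fully nested word\<close>

lemma first_occs_standardize:
  "first_occs s = map fst (filter (\<lambda>x. snd x = 1) (standardize s))"
proof (induction s rule: rev_induct)
  case Nil
  then show ?case by (simp add: first_occs_def)
next
  case (snoc x s)
  have "first_occs (s @ [x]) = (if x \<in> set s then first_occs s else first_occs s @ [x])"
    by (simp add: first_occs_def)
  then show ?case using snoc by (simp add: standardize_snoc count_list_0_iff)
qed

text \<open>First occurrences are the copies labelled 1. Restricting a list to them restricts its
  inversion set, and with all labels equal the lexicographic order is that of the letters.\<close>

lemma sorted_first_occs_iff:
  "sorted (first_occs s) \<longleftrightarrow> (\<forall>(x, y) \<in> inversion_set (standardize s). \<not> (snd x = 1 \<and> snd y = 1))"
proof -
  have "sorted (map fst q) \<longleftrightarrow> sorted q" if "\<forall>x\<in>set q. snd x = 1" for q :: "(nat \<times> nat) list"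
    using that by (induction q) (auto simp: less_eq_prod_def)
  then have "sorted (first_occs s) \<longleftrightarrow> inversion_set (filter (\<lambda>x. snd x = 1) (standardize s)) = {}"
    by (simp add: first_occs_standardize inversion_set_empty_iff)
  then show ?thesis by (fastforce simp: inversion_set_filter)
qed

lemma sorted_first_occs_eq_upt:
  assumes "set s = {1..n}"
  shows "sorted (first_occs s) \<longleftrightarrow> first_occs s = [1..<Suc n]"
proof
  assume "sorted (first_occs s)"
  moreover have "distinct (first_occs s)" by (simp add: first_occs_def)
  moreover have "set (first_occs s) = set [1..<Suc n]"
    unfolding set_upt using assms by (simp add: first_occs_def atLeastLessThanSuc_atLeastAtMost)
  ultimately show "first_occs s = [1..<Suc n]"
    by (intro sorted_distinct_set_unique sorted_upt distinct_upt)
next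
  assume eq: "first_occs s = [1..<Suc n]"
  show "sorted (first_occs s)"
    unfolding eq by (rule sorted_upt)
qed

text \<open>The increasing first half has no inversions. The decreasing second half inverts all
  pairs of second copies, and the inversions across the halves go from a first copy to a second
  copy.\<close>

lemma inversion_set_fully_nested:
  "inversion_set (standardize (fully_nested n)) =
     {((i, x), (j, y)). i \<in> {1..n} \<and> j \<in> {1..n} \<and> x \<in> {1, 2} \<and> y = 2 \<and> j < i}"
proof -
  let ?u = "[1..<Suc n]"
  \<comment> \<open>Each letter occurs once in the first half, so the offset in
    \<open>standardize_append\<close> turns label 1 into 2 throughout the second half.\<close>
  have "standardize (fully_nested n) = map (\<lambda>i. (i, 1)) ?u @ map (\<lambda>i. (i, 2)) (rev ?u)"
    unfolding fully_nested_def standardize_append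
    by (simp add: standardize_distinct count_list_distinct del: upt_Suc)
  moreover have sorted: "sorted (map (\<lambda>i. (i, k)) ?u)" for k :: nat
    unfolding sorted_map
    by (rule sorted_wrt_mono_rel[OF _ sorted_upt]) (auto simp: less_eq_prod_def)
  then have "inversion_set (map (\<lambda>i. (i, 1::nat)) ?u) = {}"
    by (simp only: inversion_set_empty_iff)
  moreover have "inversion_set (map (\<lambda>i. (i, 2::nat)) (rev ?u)) =
      {((i, x), (j, y)). i \<in> {1..n} \<and> j \<in> {1..n} \<and> x = 2 \<and> y = 2 \<and> j < i}"
    using inversion_set_rev_sorted[OF sorted[of 2]] by (auto simp: rev_map simp del: upt_Suc)
  ultimately show ?thesis
    by (auto simp del: upt_Suc simp: inversion_set_append)
qed

lemma newman_le_fully_nested_iff: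
  assumes c: "c \<in> multiperms (replicate n 2)"
  shows "newman_le c (fully_nested n) \<longleftrightarrow> first_occs c = [1..<Suc n]"
proof -
  let ?I = "inversion_set (standardize c)"
  have "set (standardize c) = set (standardize (fully_nested n))"
    using c fully_nested_in_multiperms mset_multiperms set_standardize_cong by blast
  also have "\<dots> = {1..n} \<times> {1, 2}"
  proof -
    have "count_list (fully_nested n) i = (if i \<in> {1..n} then 2 else 0)" for i
      by (simp add: fully_nested_def count_list_distinct del: upt_Suc)
    then show ?thesis by (auto simp: set_standardize split: if_splits)
  qed
  finally have st: "set (standardize c) = {1..n} \<times> {1, 2}" .
  have sub: "fst y < fst x" "x \<in> {1..n} \<times> {1, 2}" "y \<in> {1..n} \<times> {1, 2}"
    if "(x, y) \<in> ?I" for x y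
    using that inversion_set_standardize_subset[of c] inversion_set_subset[of "standardize c"] st
    by auto
  \<comment> \<open>An inversion from \<open>(i, 2)\<close> to \<open>(j, 1)\<close> forces one from
    \<open>(i, 1)\<close> to \<open>(j, 1)\<close>: apply the last clause of \<open>biclosed\<close>
    to the middle element \<open>(i, 1)\<close>, which is not inverted with
    \<open>(i, 2)\<close>.\<close>
  have no11: "(\<forall>(x, y) \<in> ?I. \<not> (snd x = 1 \<and> snd y = 1)) \<longleftrightarrow> (\<forall>(x, y) \<in> ?I. snd y = 2)"
  proof (safe, goal_cases)
    case (1 i x j y)
    show ?case
    proof (rule ccontr)
      assume "snd (j, y) \<noteq> 2"
      then have "y = 1" "x = 2" "j < i" "i \<in> {1..n}" using sub[OF 1(2)] 1 by auto
      then have "((i, 2), (i, 1)) \<in> ?I \<or> ((i, 1), (j, 1)) \<in> ?I"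
        using biclosed_standardize[of c] 1(2) st by (auto simp: biclosed_def)
      then show False using sub(1) 1(1) by fastforce
    qed
  qed auto
  have "newman_le c (fully_nested n) \<longleftrightarrow> (\<forall>(x, y) \<in> ?I. snd y = 2)"
  proof
    assume "newman_le c (fully_nested n)"
    then show "\<forall>(x, y) \<in> ?I. snd y = 2"
      unfolding newman_le_def inversion_set_fully_nested by auto
  next
    assume *: "\<forall>(x, y) \<in> ?I. snd y = 2"
    have "(x, y) \<in> inversion_set (standardize (fully_nested n))" if "(x, y) \<in> ?I" for x y
      unfolding inversion_set_fully_nested
      using sub[OF that] bspec[OF * that] by (cases x; cases y) auto
    then show "newman_le c (fully_nested n)" by (auto simp: newman_le_def)
  qed
  also have "\<dots> \<longleftrightarrow> sorted (first_occs c)"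
    by (simp only: no11 sorted_first_occs_iff)
  also have "\<dots> \<longleftrightarrow> first_occs c = [1..<Suc n]"
    using set_multiperms_2[OF c] by (rule sorted_first_occs_eq_upt)
  finally show ?thesis .
qed

section \<open>Canonical representatives of orbits\<close>

lemma orbit_sym_group: "orbit (sym_group n) map s = {map p s | p. p permutes {1..n}}"
  by (simp add: orbit_def sym_group_carrier)

lemma orbit_sym_group_map:
  assumes p: "p permutes {1..n}"
  shows "orbit (sym_group n) map (map p s) = orbit (sym_group n) map s"
proof (intro equalityI subsetI)
  fix t assume "t \<in> orbit (sym_group n) map (map p s)"
  then obtain q where "q permutes {1..n}" "t = map (q \<circ> p) s"
    unfolding orbit_sym_group map_map by blast
  then show "t \<in> orbit (sym_group n) map s"
    using permutes_compose[OF p] unfolding orbit_sym_group by blast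
next
  fix t assume "t \<in> orbit (sym_group n) map s"
  then obtain q where q: "q permutes {1..n}" "t = map q s" unfolding orbit_sym_group by blast
  then have "t = map (q \<circ> inv' p) (map p s)"
    using permutes_inverses(2)[OF p] by simp
  then show "t \<in> orbit (sym_group n) map (map p s)"
    using permutes_compose[OF permutes_inv[OF p] q(1)] unfolding orbit_sym_group by blast
qed

lemma image_mset_sum: "image_mset f (\<Sum>i\<in>A. g i) = (\<Sum>i\<in>A. image_mset f (g i))"
  by (induction A rule: infinite_finite_induct) auto

text \<open>All letters have the same multiplicity, so relabelling only reindexes the sum.\<close>

lemma map_permutes_multiperms:
  assumes s: "s \<in> multiperms (replicate n k)" and p: "p permutes {1..n}"
  shows "map p s \<in> multiperms (replicate n k)"
proof -
  have *: "multiperms (replicate n k) = {s. mset s = (\<Sum>i\<in>{1..n}. replicate_mset k i)}"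
    unfolding multiperms_def by (auto intro!: sum.cong arg_cong2[where f = replicate_mset])
  have "mset (map p s) = image_mset p (\<Sum>i\<in>{1..n}. replicate_mset k i)"
    using s by (simp add: *)
  also have "\<dots> = (\<Sum>i\<in>{1..n}. replicate_mset k (p i))"
    by (simp add: image_mset_sum)
  also have "\<dots> = (\<Sum>i\<in>{1..n}. replicate_mset k i)"
    by (rule sum.permute[OF p, unfolded comp_def, symmetric])
  finally show ?thesis by (simp add: *)
qed

text \<open>The list \<open>first_occs s\<close> is the one-line notation of
  \<open>first_occs_perm s\<close>, and \<open>first_occs\<close> commutes with injective
  relabellings; the inverse permutation therefore turns it into the identity word.\<close>

lemma first_occs_map_inv:
  assumes "set s = {1..n}"
  shows "first_occs (map (inv' (first_occs_perm s)) s) = [1..<Suc n]"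
proof -
  have p: "first_occs_perm s permutes {1..n}" using assms by (rule first_occs_perm_permutes)
  have len: "length (first_occs s) = n"
    using distinct_card[of "first_occs s"] assms by (simp add: first_occs_def)
  have "first_occs s = map (first_occs_perm s) [1..<Suc n]"
    by (rule nth_equalityI) (auto simp: len first_occs_perm_def simp del: upt_Suc)
  then have "map (inv' (first_occs_perm s)) (first_occs s) = [1..<Suc n]"
    using permutes_inverses(2)[OF p] by (simp add: comp_def del: upt_Suc)
  then show ?thesis
    using first_occs_map permutes_inj[OF permutes_inv[OF p]] by metis
qed

text \<open>A representative lies in its own orbit, so taking orbits is a left inverse, which gives
  injectivity. For surjectivity, every word of the ideal represents its own orbit.\<close>

lemma bij_betw_canonical_rep:
  "bij_betw canonical_rep (carrier (barcode_poset n))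
     (carrier (principal_ideal (newman (replicate n 2)) (fully_nested n)))"
proof -
  let ?M = "multiperms (replicate n 2)" and ?orb = "orbit (sym_group n) map"
  let ?c = "\<lambda>s. map (inv' (first_occs_perm s)) s"
  have perm: "inv' (first_occs_perm s) permutes {1..n}" if "s \<in> ?M" for s
    using that set_multiperms_2 first_occs_perm_permutes permutes_inv by blast
  have orb: "?orb (canonical_rep (?orb s)) = ?orb s" if "s \<in> ?M" for s
    unfolding canonical_rep_orbit[OF that] by (rule orbit_sym_group_map[OF perm[OF that]])
  have carr: "carrier (barcode_poset n) = ?orb ` ?M"
    by (auto simp: barcode_poset_def orbits_def)
  have ideal: "carrier (principal_ideal (newman (replicate n 2)) (fully_nested n)) =
      {c \<in> ?M. first_occs c = [1..<Suc n]}"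
    using newman_le_fully_nested_iff by auto
  have inj: "inj_on canonical_rep (?orb ` ?M)"
    by (rule inj_on_inverseI[where g = ?orb]) (auto simp: orb)
  have "canonical_rep ` ?orb ` ?M = {c \<in> ?M. first_occs c = [1..<Suc n]}"
  proof (intro equalityI subsetI)
    fix c assume "c \<in> canonical_rep ` ?orb ` ?M"
    then obtain s where s: "s \<in> ?M" "c = canonical_rep (?orb s)" by blast
    then have "c = ?c s" by (simp only: canonical_rep_orbit)
    with s(1) show "c \<in> {c \<in> ?M. first_occs c = [1..<Suc n]}"
      using map_permutes_multiperms perm first_occs_map_inv set_multiperms_2 by blast
  next
    fix c assume "c \<in> {c \<in> ?M. first_occs c = [1..<Suc n]}"
    then have c: "c \<in> ?M" "first_occs c = [1..<Suc n]" by auto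
    \<comment> \<open>Outside \<open>{1..n}\<close> the default value \<open>i\<close> in
      \<open>first_occs_perm\<close> makes this an equality of functions.\<close>
    then have "first_occs_perm c = id"
      by (auto simp: first_occs_perm_def fun_eq_iff simp del: upt_Suc)
    then have "canonical_rep (?orb c) = c" using c by (simp add: canonical_rep_orbit)
    then show "c \<in> canonical_rep ` ?orb ` ?M" using c by (metis image_eqI)
  qed
  with inj show ?thesis by (simp only: bij_betw_def carr ideal)
qed

theorem theorem1:
  fixes n :: nat
  assumes "n \<ge> 1"
  shows "order_isomorphic (barcode_poset n)
           (principal_ideal (newman (replicate n 2)) (fully_nested n))
         \<and> lattice (barcode_poset n)"
proof -
  let ?B = "barcode_poset n"
  let ?P = "principal_ideal (newman (replicate n 2)) (fully_nested n)"
  interpret P: lattice ?P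
    using fully_nested_in_multiperms by (rule newman_ideal_lattice)
  note bij = bij_betw_canonical_rep[of n]
  have le: "le ?B = (\<lambda>A B. newman_le (canonical_rep A) (canonical_rep B))" and eq: "eq ?B = (=)"
    by (simp_all add: barcode_poset_def)
  \<comment> \<open>Antisymmetry is the one order axiom on orbits that does not follow from
    inclusion of inversion sets alone: it needs representatives to determine their orbits.\<close>
  have "A = B" if "le ?B A B" "le ?B B A" "A \<in> carrier ?B" "B \<in> carrier ?B" for A B
  proof -
    have "canonical_rep A = canonical_rep B"
      using P.le_antisym bij_betwE[OF bij] that unfolding le le_newman_ideal by blast
    then show ?thesis using that bij by (auto simp: bij_betw_def inj_on_def)
  qed
  then have "weak_partial_order ?B"
    by unfold_locales (auto simp: le eq newman_le_def)
  then have "order_emb ?B ?P canonical_rep"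
    using P.weak_partial_order_axioms by (simp add: order_emb_def le)
  then have iso: "order_isomorphic ?B ?P"
    using bij by (auto simp: order_isomorphic_def)
  then show ?thesis
    using order_isomorphic_lattice P.lattice_axioms eq by blast
qed

end
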